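(* Let $\mathbb{T}=\{\lambda\in\mathbb{C}:|\lambda|=1\}$. There exist an admissible $p\in C(\mathbb{T})[t]$ and $T\in\mathrm{End}(C(\mathbb{T}))$ such that $T$ extends to $C(\mathbb{T}_{p})$ via $\pi_{\mathbb{T}}^{*}$ but $T$ does not extend to $C(\mathbb{T})_{p}$ via $\pi_{\mathbb{T}}^{*}$.
   Context: All algebras are commutative, unital, complex algebras; $\mathrm{End}(A)$ is the set of unital algebra endomorphisms of $A$. A compact space means a compact Hausdorff space. For a compact space $X$, $C(X)$ is the algebra of continuous complex-valued functions on $X$. Let $X$ be a compact space and let $p\in C(X)[t]$ be monic of degree at least $2$. For $x \in X$ let $p^{(\widehat x)}\in\mathbb{C}[t]$ be the polynomial obtained by evaluating the coefficients of $p$ at $x$. Put $X_p=\{(x,\lambda)\in X\times\mathbb{C}: p^{(\widehat x)}(\lambda)=0\}$, a compact space, and let $\pi_X:X_p\to X$ and $\pi_p:X_p\to\mathbb{C}$ be the restrictions of the coordinate projections. Define $\pi_X^*:C(X)\to C(X_p)$ by $\pi_X^*(g)=g\circ\pi_X$; this is an injective unital homomorphism. The discriminant $D_p\in C(X)$ is $D_p(x)=\prod_{i<j}(\lambda_i-\lambda_j)^2$, where $p^{(\widehat x)}=(t-\lambda_1)\cdots(t-\lambda_n)$. The polynomial $p$ is called admissible if it is monic, of degree at least $2$, and the zero set $Z(D_p)$ of $D_p$ has empty interior in $X$. $C(X)_p$ denotes the subalgebra of $C(X_p)$ generated by $\{\pi_p\}\cup\pi_X^*(C(X))$, i.e. the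 set of all functions $\sum_{k=0}^m (q_k\circ\pi_X)\pi_p^k$ with $q_k\in C(X)$. If $B$ is $C(X)_p$ or $C(X_p)$, then $T\in\mathrm{End}(C(X))$ extends to $B$ via $\pi_X^*$ if there is $T'\in\mathrm{End}(B)$ with $T'\pi_X^*=\pi_X^*T$. These notions are used with $X=\mathbb{T}$. *)

theory Defs
  imports "HOL-Analysis.Analysis" "HOL-Algebra.UnivPoly"
    "HOL-Computational_Algebra.Computational_Algebra"
begin

text \<open>
  A space is a subset of a topological type, with the subspace topology. Functions on it are
  extensional, so that equality in the algebra is equality on the set.
\<close>

definition C_alg :: "'a::topological_space set \<Rightarrow> (complex, 'a \<Rightarrow> complex) module" where
  "C_alg X = \<lparr>carrier = {f \<in> extensional X. continuous_on X f},
     mult = (\<lambda>f g. \<lambda>x\<in>X. f x * g x),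
     one = (\<lambda>x\<in>X. 1),
     zero = (\<lambda>x\<in>X. 0),
     add = (\<lambda>f g. \<lambda>x\<in>X. f x + g x),
     smult = (\<lambda>c f. \<lambda>x\<in>X. c * f x)\<rparr>"

lemma C_alg_simps [simp]:
  "carrier (C_alg X) = {f \<in> extensional X. continuous_on X f}"
  "f \<otimes>\<^bsub>C_alg X\<^esub> g = (\<lambda>x\<in>X. f x * g x)"
  "\<one>\<^bsub>C_alg X\<^esub> = (\<lambda>x\<in>X. 1)"
  "\<zero>\<^bsub>C_alg X\<^esub> = (\<lambda>x\<in>X. 0)"
  "f \<oplus>\<^bsub>C_alg X\<^esub> g = (\<lambda>x\<in>X. f x + g x)"
  "c \<odot>\<^bsub>C_alg X\<^esub> f = (\<lambda>x\<in>X. c * f x)"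
  by (simp_all add: C_alg_def)

lemma continuous_on_restrict_iff [simp]: "continuous_on X (restrict f X) \<longleftrightarrow> continuous_on X f"
  by (rule continuous_on_cong) auto

lemma cring_C_alg: "cring (C_alg X)"
proof (rule cringI)
  show "abelian_group (C_alg X)"
  proof (rule abelian_groupI)
    fix f assume f: "f \<in> carrier (C_alg X)"
    show "\<exists>g\<in>carrier (C_alg X). g \<oplus>\<^bsub>C_alg X\<^esub> f = \<zero>\<^bsub>C_alg X\<^esub>"
      using f by (intro bexI[of _ "\<lambda>x\<in>X. - f x"]) (auto intro!: continuous_intros ext)
  qed (auto simp: extensional_def fun_eq_iff intro!: continuous_intros)
  show "Group.comm_monoid (C_alg X)"
    by (rule comm_monoidI) (auto simp: extensional_def fun_eq_iff intro!: continuous_intros)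
qed (auto simp: fun_eq_iff algebra_simps)

text \<open>
  Only the values on the carriers matter; what a homomorphism does outside is left free,
  as for \<^const>\<open>ring_hom\<close>.
\<close>

definition alg_hom :: "(complex, 'f) module \<Rightarrow> (complex, 'g) module \<Rightarrow> ('f \<Rightarrow> 'g) set" where
  "alg_hom A B =
     {T \<in> ring_hom A B. \<forall>c. \<forall>a \<in> carrier A. T (c \<odot>\<^bsub>A\<^esub> a) = c \<odot>\<^bsub>B\<^esub> T a}"

abbreviation alg_End :: "(complex, 'f) module \<Rightarrow> ('f \<Rightarrow> 'f) set" where
  "alg_End A \<equiv> alg_hom A A"

definition unital_subalgebra :: "'f set \<Rightarrow> (complex, 'f) module \<Rightarrow> bool" where
  "unital_subalgebra S A \<longleftrightarrow> S \<subseteq> carrier A \<and> \<one>\<^bsub>A\<^esub> \<in> S \<and>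
     (\<forall>a\<in>S. \<forall>b\<in>S. a \<oplus>\<^bsub>A\<^esub> b \<in> S \<and> a \<otimes>\<^bsub>A\<^esub> b \<in> S) \<and> (\<forall>c. \<forall>a\<in>S. c \<odot>\<^bsub>A\<^esub> a \<in> S)"

definition generated_subalgebra :: "(complex, 'f) module \<Rightarrow> 'f set \<Rightarrow> 'f set" where
  "generated_subalgebra A H = \<Inter>{S. unital_subalgebra S A \<and> H \<subseteq> S}"

definition poly_at :: "'a::topological_space set \<Rightarrow> (nat \<Rightarrow> 'a \<Rightarrow> complex) \<Rightarrow> 'a \<Rightarrow> complex poly" where
  "poly_at X p x =
     (\<Sum>k\<le>deg (C_alg X) p. Polynomial.monom (up_ring.coeff (UP (C_alg X)) p k x) k)"

definition discr_of_roots :: "complex list \<Rightarrow> complex" where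
  "discr_of_roots ls = (\<Prod>j<length ls. \<Prod>i<j. (ls ! i - ls ! j)\<^sup>2)"

text \<open>The value does not depend on the ordering of the roots, see \<open>discr_eq\<close> below.\<close>

definition discr :: "complex poly \<Rightarrow> complex" where
  "discr q = (THE d. \<exists>ls. q = (\<Prod>l\<leftarrow>ls. [:- l, 1:]) \<and> d = discr_of_roots ls)"

lemma discr_of_roots_Cons:
  "discr_of_roots (x # xs) = (\<Prod>y\<leftarrow>xs. (x - y)\<^sup>2) * discr_of_roots xs"
proof -
  have "discr_of_roots (x # xs) =
      (\<Prod>j<length xs. (x - xs ! j)\<^sup>2) * discr_of_roots xs"
    unfolding discr_of_roots_def
    by (simp add: prod.lessThan_Suc_shift prod.distrib del: prod.lessThan_Suc)
  also have "(\<Prod>j<length xs. (x - xs ! j)\<^sup>2) = (\<Prod>y\<leftarrow>xs. (x - y)\<^sup>2)"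
    by (induction xs) (simp_all add: prod.lessThan_Suc_shift del: prod.lessThan_Suc)
  finally show ?thesis .
qed

lemma discr_of_roots_move:
  "discr_of_roots (as @ x # bs) = discr_of_roots (x # as @ bs)"
  by (induction as) (simp_all add: discr_of_roots_Cons power2_commute)

lemma discr_of_roots_mset:
  "mset xs = mset ys \<Longrightarrow> discr_of_roots xs = discr_of_roots ys"
proof (induction xs arbitrary: ys)
  case (Cons x xs)
  then have "x \<in> set ys"
    by (metis list.set_intros(1) mset_eq_setD)
  then obtain as bs where ys: "ys = as @ x # bs"
    by (meson split_list)
  with Cons.prems have ms: "mset xs = mset (as @ bs)"
    by simp
  have "(\<Prod>y\<leftarrow>xs. (x - y)\<^sup>2) = (\<Prod>y\<in>#mset xs. (x - y)\<^sup>2)"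
    by (metis mset_map prod_mset_prod_list)
  also have "\<dots> = (\<Prod>y\<leftarrow>as @ bs. (x - y)\<^sup>2)"
    by (metis ms mset_map prod_mset_prod_list)
  finally show ?case
    unfolding ys discr_of_roots_move using Cons.IH[OF ms] by (simp add: discr_of_roots_Cons)
qed simp

lemma proots_linear_prod: "proots (\<Prod>l\<leftarrow>ls. [:- l, 1:]) = mset (ls :: complex list)"
proof (induction ls)
  case (Cons l ls)
  have "(\<Prod>l\<leftarrow>ls. [:- l, 1:]) \<noteq> (0 :: complex poly)"
    by (auto simp: prod_list_zero_iff)
  then show ?case
    using Cons by (simp add: proots_mult del: mult_pCons_left)
qed simp

lemma discr_eq: "discr (\<Prod>l\<leftarrow>ls. [:- l, 1:]) = discr_of_roots ls"
  unfolding discr_def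
proof (rule the_equality)
  fix d assume "\<exists>ls'. (\<Prod>l\<leftarrow>ls. [:- l, 1:]) = (\<Prod>l\<leftarrow>ls'. [:- l, 1:]) \<and> d = discr_of_roots ls'"
  then show "d = discr_of_roots ls"
    by (metis discr_of_roots_mset proots_linear_prod)
qed blast

definition discriminant ::
    "'a::topological_space set \<Rightarrow> (nat \<Rightarrow> 'a \<Rightarrow> complex) \<Rightarrow> 'a \<Rightarrow> complex" where
  "discriminant X p = (\<lambda>x\<in>X. discr (poly_at X p x))"

definition admissible :: "'a::topological_space set \<Rightarrow> (nat \<Rightarrow> 'a \<Rightarrow> complex) \<Rightarrow> bool" where
  "admissible X p \<longleftrightarrow> p \<in> carrier (UP (C_alg X)) \<and>
     up_ring.coeff (UP (C_alg X)) p (deg (C_alg X) p) = \<one>\<^bsub>C_alg X\<^esub> \<and>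
     2 \<le> deg (C_alg X) p \<and>
     top_of_set X interior_of {x \<in> X. discriminant X p x = 0} = {}"

definition root_space ::
    "'a::topological_space set \<Rightarrow> (nat \<Rightarrow> 'a \<Rightarrow> complex) \<Rightarrow> ('a \<times> complex) set" where
  "root_space X p = {(x, l). x \<in> X \<and> poly (poly_at X p x) l = 0}"

definition pullback ::
    "'a::topological_space set \<Rightarrow> (nat \<Rightarrow> 'a \<Rightarrow> complex) \<Rightarrow> ('a \<Rightarrow> complex) \<Rightarrow> 'a \<times> complex \<Rightarrow> complex" where
  "pullback X p g = (\<lambda>z\<in>root_space X p. g (fst z))"

definition root_proj ::
    "'a::topological_space set \<Rightarrow> (nat \<Rightarrow> 'a \<Rightarrow> complex) \<Rightarrow> 'a \<times> complex \<Rightarrow> complex" where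
  "root_proj X p = (\<lambda>z\<in>root_space X p. snd z)"

definition C_adj ::
    "'a::topological_space set \<Rightarrow> (nat \<Rightarrow> 'a \<Rightarrow> complex) \<Rightarrow> (complex, 'a \<times> complex \<Rightarrow> complex) module" where
  "C_adj X p = (C_alg (root_space X p))
     \<lparr>carrier := generated_subalgebra (C_alg (root_space X p))
        ({root_proj X p} \<union> pullback X p ` carrier (C_alg X))\<rparr>"

lemma pullback_continuous:
  assumes "continuous_on X g"
  shows "continuous_on (root_space X p) (\<lambda>z. g (fst z))"
  by (rule continuous_on_compose2[OF assms]) (auto simp: root_space_def intro!: continuous_intros)

lemma pullback_alg_hom: "pullback X p \<in> alg_hom (C_alg X) (C_alg (root_space X p))"
  unfolding alg_hom_def ring_hom_def
  by (auto simp: pullback_def pullback_continuous fun_eq_iff)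
     (auto simp: root_space_def)

lemma carrier_C_adj:
  "carrier (C_adj X p) =
     {\<lambda>z\<in>root_space X p. \<Sum>k\<le>m. q k (fst z) * snd z ^ k | m q. \<forall>k. q k \<in> carrier (C_alg X)}"
  (is "_ = ?R")
proof -
  let ?Y = "root_space X p" and ?A = "C_alg (root_space X p)"
  let ?F = "\<lambda>m q. \<lambda>z\<in>?Y. \<Sum>k\<le>(m::nat). q k (fst z) * snd z ^ k :: complex"
  let ?H = "{root_proj X p} \<union> pullback X p ` carrier (C_alg X)"
  have Y: "fst z \<in> X" if "z \<in> ?Y" for z
    using that by (auto simp: root_space_def)
  have RI: "f \<in> ?R" if "\<And>k. continuous_on X (q k)" "f \<in> extensional ?Y"
    "\<And>z. z \<in> ?Y \<Longrightarrow> f z = (\<Sum>k\<le>m. q k (fst z) * snd z ^ k)" for f m q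
  proof -
    have "f = ?F m (\<lambda>k. restrict (q k) X)"
    proof (rule extensionalityI[of _ ?Y])
      fix z assume z: "z \<in> ?Y"
      show "f z = ?F m (\<lambda>k. restrict (q k) X) z"
        using Y[OF z] that(3)[OF z] z by simp
    qed (use that in auto)
    moreover have "\<forall>k. restrict (q k) X \<in> carrier (C_alg X)"
      using that(1) by simp
    ultimately show ?thesis
      by (intro CollectI exI[of _ m] exI[of _ "\<lambda>k. restrict (q k) X"] conjI)
  qed
  have sub: "unital_subalgebra ?R ?A"
    unfolding unital_subalgebra_def
  proof (intro conjI ballI allI)
    show "?R \<subseteq> carrier ?A"
      by (auto intro!: continuous_intros pullback_continuous)
    show "\<one>\<^bsub>?A\<^esub> \<in> ?R"
      by (rule RI[of "\<lambda>_ _. 1" _ 0]) auto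
  next
    fix c f assume "f \<in> ?R"
    then obtain m q where f: "f = ?F m q" and q: "\<And>k. continuous_on X (q k)"
      by auto
    show "c \<odot>\<^bsub>?A\<^esub> f \<in> ?R"
      by (rule RI[of "\<lambda>k x. c * q k x" _ m])
         (auto simp: f sum_distrib_left mult.assoc intro!: continuous_intros q)
  next
    fix f g assume "f \<in> ?R" "g \<in> ?R"
    then obtain m q n r where f: "f = ?F m q" and q: "\<And>k. continuous_on X (q k)"
      and g: "g = ?F n r" and r: "\<And>k. continuous_on X (r k)"
      by auto
    have sum_pad: "(\<Sum>k\<le>M. if k \<le> a then h k else 0) = sum h {..a}"
      if "a \<le> M" for a M and h :: "nat \<Rightarrow> complex"
      using that by (intro sum.mono_neutral_cong_right) auto
    define M where "M = max m n"
    define s where "s = (\<lambda>k x. (if k \<le> m then q k x else 0) + (if k \<le> n then r k x else 0))"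
    have s: "continuous_on X (s k)" for k
      unfolding s_def using q r
      by (cases "k \<le> m"; cases "k \<le> n") (auto intro!: continuous_intros)
    show "f \<oplus>\<^bsub>?A\<^esub> g \<in> ?R"
    proof (rule RI[of s _ M])
      fix z assume z: "z \<in> ?Y"
      have "(\<Sum>k\<le>M. s k (fst z) * snd z ^ k) =
          (\<Sum>k\<le>M. if k \<le> m then q k (fst z) * snd z ^ k else 0) +
          (\<Sum>k\<le>M. if k \<le> n then r k (fst z) * snd z ^ k else 0)"
        unfolding s_def sum.distrib[symmetric]
        by (intro sum.cong) (auto simp: algebra_simps)
      then show "(f \<oplus>\<^bsub>?A\<^esub> g) z = (\<Sum>k\<le>M. s k (fst z) * snd z ^ k)"
        using z by (simp add: f g sum_pad M_def)
    qed (auto simp: s)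
    define t where "t = (\<lambda>k x. \<Sum>i\<le>k. (if i \<le> m then q i x else 0) *
      (if k - i \<le> n then r (k - i) x else 0))"
    have t: "continuous_on X (t k)" for k
      unfolding t_def
    proof (intro continuous_on_sum continuous_on_mult)
      show "continuous_on X (\<lambda>x. if i \<le> m then q i x else 0)" for i
        using q by (cases "i \<le> m") auto
      show "continuous_on X (\<lambda>x. if k - i \<le> n then r (k - i) x else 0)" for i
        using r by (cases "k - i \<le> n") auto
    qed
    show "f \<otimes>\<^bsub>?A\<^esub> g \<in> ?R"
    proof (rule RI[of t _ "m + n"])
      fix z assume z: "z \<in> ?Y"
      define a b where "a = (\<lambda>i. if i \<le> m then q i (fst z) else 0)"
        and "b = (\<lambda>i. if i \<le> n then r i (fst z) else 0)"
      have "(\<Sum>i\<le>m. a i * snd z ^ i) * (\<Sum>j\<le>n. b j * snd z ^ j) =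
          (\<Sum>k\<le>m + n. (\<Sum>i\<le>k. a i * b (k - i)) * snd z ^ k)"
        by (rule polynomial_product) (auto simp: a_def b_def)
      then show "(f \<otimes>\<^bsub>?A\<^esub> g) z = (\<Sum>k\<le>m + n. t k (fst z) * snd z ^ k)"
        using z by (simp add: f g t_def a_def b_def)
    qed (auto simp: t)
  qed
  have "root_proj X p \<in> ?R"
    by (rule RI[of "\<lambda>k _. if k = 1 then 1 else 0" _ 1]) (auto simp: root_proj_def)
  moreover have "pullback X p g \<in> ?R" if "g \<in> carrier (C_alg X)" for g
    by (rule RI[of "\<lambda>_. g" _ 0]) (use that in \<open>auto simp: pullback_def\<close>)
  ultimately have "?H \<subseteq> ?R"
    by blast
  moreover have "?R \<subseteq> S" if S: "unital_subalgebra S ?A" and H: "?H \<subseteq> S" for S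
  proof clarify
    fix m :: nat and q :: "nat \<Rightarrow> 'a \<Rightarrow> complex" assume q: "\<forall>k. q k \<in> carrier (C_alg X)"
    have one: "(\<lambda>z\<in>?Y. 1) \<in> S"
      and add: "\<And>f g. f \<in> S \<Longrightarrow> g \<in> S \<Longrightarrow> (\<lambda>z\<in>?Y. f z + g z) \<in> S"
      and mul: "\<And>f g. f \<in> S \<Longrightarrow> g \<in> S \<Longrightarrow> (\<lambda>z\<in>?Y. f z * g z) \<in> S"
      using S by (auto simp: unital_subalgebra_def)
    have proj: "root_proj X p \<in> S"
      using H by auto
    have pow: "(\<lambda>z\<in>?Y. snd z ^ k) \<in> S" for k
    proof (induction k)
      case (Suc k)
      have "(\<lambda>z\<in>?Y. snd z ^ Suc k) = (\<lambda>z\<in>?Y. root_proj X p z * (\<lambda>z\<in>?Y. snd z ^ k) z)"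
        by (auto simp: root_proj_def fun_eq_iff)
      then show ?case
        using mul[OF proj Suc] by (simp only:)
    qed (use one in \<open>simp only: power_0\<close>)
    have summand: "(\<lambda>z\<in>?Y. q k (fst z) * snd z ^ k) \<in> S" for k
    proof -
      have "pullback X p (q k) \<in> S"
        using H q by blast
      moreover have "(\<lambda>z\<in>?Y. q k (fst z) * snd z ^ k) =
          (\<lambda>z\<in>?Y. pullback X p (q k) z * (\<lambda>z\<in>?Y. snd z ^ k) z)"
        by (auto simp: pullback_def fun_eq_iff)
      ultimately show ?thesis
        using mul[OF _ pow[of k]] by (simp only:)
    qed
    show "?F m q \<in> S"
    proof (induction m)
      case (Suc m)
      have "?F (Suc m) q = (\<lambda>z\<in>?Y. ?F m q z + (\<lambda>z\<in>?Y. q (Suc m) (fst z) * snd z ^ Suc m) z)"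
        by (auto simp: fun_eq_iff)
      then show ?case
        using add[OF Suc summand[of "Suc m"]] by (simp only:)
    qed (use summand[of 0] in \<open>simp only: atMost_0 sum.insert[OF finite.emptyI] sum.empty empty_iff not_False_eq_True add_0_right\<close>)
  qed
  ultimately have "generated_subalgebra ?A ?H = ?R"
    unfolding generated_subalgebra_def using sub by blast
  then show ?thesis
    by (simp add: C_adj_def del: C_alg_simps)
qed

definition extends_via :: "('f \<Rightarrow> 'g) \<Rightarrow> (complex, 'f) module \<Rightarrow> (complex, 'g) module \<Rightarrow> ('f \<Rightarrow> 'f) \<Rightarrow> bool" where
  "extends_via \<phi> A B T \<longleftrightarrow> (\<exists>T'\<in>alg_End B. \<forall>g\<in>carrier A. T' (\<phi> g) = \<phi> (T g))"

definition unit_circle :: "complex set" where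
  "unit_circle = {z. cmod z = 1}"

end

(* Take p = (t^2 - x)(t^3 - x): its root space is the union of the double and the triple cover of the
   circle, which meet only at (1, 1). Let T be composition with the degree one map
   f(e^{it}) = e^{ig(t)}, where g(t) = t + sqrt(sin t) for small t > 0. Multiplying the roots by
   e^{i(g-t)/2} and e^{i(g-t)/3} on the two covers lifts f to the root space. Conversely, an
   extension of T to C(T)_p sends the second coordinate to a function G that gives a root of p over f,
   and monodromy forces G to be the above lift near (1, 1). There G(x, e^{it/2}) - G(x, e^{it/3}) is
   of order sqrt t, whereas polynomials in the second coordinate are Lipschitz in it, and the two
   arguments differ by only O(t). *)
theory Submission
  imports Defs "HOL-Real_Asymp.Real_Asymp"
begin

section \<open>The polynomial (t^2 - x)(t^3 - x) = t^5 - x t^3 - x t^2 + x^2 and its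
  admissibility\<close>

definition two_three_poly :: "nat \<Rightarrow> complex \<Rightarrow> complex" where
  "two_three_poly k = (\<lambda>x\<in>unit_circle.
     if k = 0 then x\<^sup>2 else if k = 2 \<or> k = 3 then - x else if k = 5 then 1 else 0)"

text \<open>At e^{it} this is sqrt(sin t) on the upper half circle and 0 on the lower one. A
  single-valued phase keeps the degree of \<open>twist\<close> equal to one, and the square root
  destroys the Lipschitz property at 1.\<close>

definition phase :: "complex \<Rightarrow> real" where
  "phase z = sqrt (max 0 (Im z))"

definition twist :: "complex \<Rightarrow> complex" where
  "twist z = z * cis (phase z)"

lemma two_three_poly_carrier: "two_three_poly \<in> carrier (UP (C_alg unit_circle))"
proof -
  have "two_three_poly k \<in> carrier (C_alg unit_circle)" for k
    by (cases "k = 0"; cases "k = 2 \<or> k = 3"; cases "k = 5")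
      (auto simp: two_three_poly_def intro!: continuous_intros)
  moreover have "bound \<zero>\<^bsub>C_alg unit_circle\<^esub> 5 two_three_poly"
    by (rule bound.intro) (auto simp: two_three_poly_def)
  ultimately show ?thesis
    by (auto simp: UP_def up_def simp del: C_alg_simps)
qed

lemma coeff_two_three_poly [simp]:
  "up_ring.coeff (UP (C_alg unit_circle)) two_three_poly = two_three_poly"
  using two_three_poly_carrier by (simp add: UP_def)

lemma one_in_unit_circle [simp]: "1 \<in> unit_circle"
  by (simp add: unit_circle_def)

lemma deg_two_three_poly [simp]: "deg (C_alg unit_circle) two_three_poly = 5"
proof -
  interpret UP_cring "C_alg unit_circle" "UP (C_alg unit_circle)"
    by (simp_all add: UP_cring_def cring_C_alg)
  have "two_three_poly 5 1 \<noteq> 0" "\<zero>\<^bsub>C_alg unit_circle\<^esub> 1 = 0"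
    by (simp_all add: two_three_poly_def)
  then have "two_three_poly 5 \<noteq> \<zero>\<^bsub>C_alg unit_circle\<^esub>"
    by metis
  then show ?thesis
    using two_three_poly_carrier
    by (intro order_antisym deg_aboveI deg_belowI)
      (auto simp: two_three_poly_def simp del: C_alg_simps(1))
qed

lemma poly_at_two_three_poly:
  assumes "x \<in> unit_circle"
  shows "poly_at unit_circle two_three_poly x = [:- x, 0, 1:] * [:- x, 0, 0, 1:]"
  using assms unfolding poly_at_def deg_two_three_poly coeff_two_three_poly two_three_poly_def
  by (simp add: eval_nat_numeral Polynomial.monom_Suc Polynomial.monom_0)

lemma root_space_two_three_poly:
  "root_space unit_circle two_three_poly =
     {z. cmod (fst z) = 1 \<and> snd z ^ 2 = fst z} \<union> {z. cmod (fst z) = 1 \<and> snd z ^ 3 = fst z}"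
proof -
  have "poly (poly_at unit_circle two_three_poly x) l = (l ^ 2 - x) * (l ^ 3 - x)"
    if "cmod x = 1" for x l
    using that
    by (subst poly_at_two_three_poly)
      (simp_all add: unit_circle_def algebra_simps eval_nat_numeral)
  then show ?thesis
    by (auto simp: root_space_def unit_circle_def)
qed

text \<open>Since x l = l^3 = x, cancelling x leaves l = 1. Hence the two covers meet only at (1,
  1).\<close>

lemma square_eq_cube_imp_one:
  fixes l x :: "'a::idom"
  assumes "l ^ 2 = x" "l ^ 3 = x" "x \<noteq> 0"
  shows "l = 1"
proof -
  have "x * l = x * 1"
    using assms by (simp add: eval_nat_numeral mult_ac)
  with assms(3) show ?thesis
    by (simp only: mult_cancel_left) simp
qed

text \<open>If the product over pairs vanishes, the list of roots repeats some l. Then (t - l)^2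
  divides q, so q and its derivative both vanish at l.\<close>

lemma discr_nonzero:
  fixes q :: "complex poly"
  assumes monic: "lead_coeff q = 1" and simple: "\<And>l. poly q l = 0 \<Longrightarrow> poly (pderiv q) l \<noteq> 0"
  shows "discr q \<noteq> 0"
proof
  assume 0: "discr q = 0"
  have "q \<noteq> 0"
    using monic by auto
  then obtain A where "q = Polynomial.smult (lead_coeff q) (\<Prod>x\<in>#A. [:-x, 1:])"
    using alg_closed_imp_factorization by blast
  moreover obtain ls where "A = mset ls"
    using ex_mset by metis
  ultimately have q: "q = (\<Prod>l\<leftarrow>ls. [:-l, 1:])"
    using monic by (metis mset_map prod_mset_prod_list smult_1_left)
  have "discr_of_roots ls = 0"
    using 0 q by (metis discr_eq)
  then obtain i j where ij: "i < j" "j < length ls" "ls ! i = ls ! j"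
    by (auto simp: discr_of_roots_def)
  then have "\<not> distinct ls"
    using nth_eq_iff_index_eq[of ls i j] by auto
  then obtain us l vs ws where ls: "ls = us @ [l] @ vs @ [l] @ ws"
    by (blast dest: not_distinct_decomp)
  have "q = [:-l, 1:] * ([:-l, 1:] * ((\<Prod>l\<leftarrow>us. [:-l, 1:]) * (\<Prod>l\<leftarrow>vs. [:-l, 1:]) *
      (\<Prod>l\<leftarrow>ws. [:-l, 1:])))"
    by (simp only: q ls map_append list.map prod_list.append prod_list.Cons prod_list.Nil
        mult_ac mult_1_left)
  then obtain r where r: "q = [:-l, 1:] * ([:-l, 1:] * r)"
    by blast
  have "poly q l = 0" "poly (pderiv q) l = 0"
    unfolding r by (simp_all only: pderiv_mult poly_add poly_mult) simp_all
  with simple show False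
    by blast
qed

text \<open>Away from x = 1 all roots are simple, so the discriminant vanishes at most at 1; and a
  single point is not open in the connected circle.\<close>

lemma admissible_two_three_poly: "admissible unit_circle two_three_poly"
proof -
  let ?Z = "{x \<in> unit_circle. discriminant unit_circle two_three_poly x = 0}"
  have "discr (poly_at unit_circle two_three_poly x) \<noteq> 0"
    if x: "x \<in> unit_circle" "x \<noteq> 1" for x
    unfolding poly_at_two_three_poly[OF x(1)]
  proof (rule discr_nonzero)
    let ?q = "[:- x, 0, 1:] * [:- x, 0, 0, 1:]"
    show "lead_coeff ?q = 1"
      by (simp only: lead_coeff_mult) simp
    have x0: "x \<noteq> 0"
      using x by (auto simp: unit_circle_def)
    fix l assume "poly ?q l = 0"
    then have "l ^ 2 = x \<or> l ^ 3 = x"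
      by (simp only: poly_mult) (auto simp: eval_nat_numeral)
    then have l0: "l \<noteq> 0" and ne: "\<not> (l ^ 2 = x \<and> l ^ 3 = x)"
      using x x0 square_eq_cube_imp_one[of l x] by auto
    \<comment> \<open>At a root exactly one of the two factors vanishes, so exactly one summand
      survives, and it is nonzero because l is.\<close>
    have "poly (pderiv ?q) l = 3 * l ^ 2 * (l ^ 2 - x) + 2 * l * (l ^ 3 - x)"
      by (simp only: pderiv_mult poly_add poly_mult)
        (simp add: pderiv_pCons eval_nat_numeral algebra_simps)
    then show "poly (pderiv ?q) l \<noteq> 0"
      using l0 ne \<open>l ^ 2 = x \<or> l ^ 3 = x\<close> by auto
  qed
  then have Z: "?Z \<subseteq> {1}"
    by (auto simp: discriminant_def)
  have "connected unit_circle"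
    using connected_sphere[of "0::complex" 1]
    by (simp add: unit_circle_def sphere_def dist_norm)
  moreover have "-1 \<in> unit_circle"
    by (simp add: unit_circle_def)
  ultimately have "\<not> openin (top_of_set unit_circle) {1}"
    unfolding connected_clopen
    by (metis closed_singleton closed_subset empty_iff empty_subsetI insert_subset
        one_in_unit_circle one_neq_neg_one singletonD)
  moreover have "top_of_set unit_circle interior_of ?Z \<subseteq> {1}"
    using interior_of_subset Z by (rule order_trans)
  ultimately have "top_of_set unit_circle interior_of ?Z = {}"
    using openin_interior_of[of "top_of_set unit_circle" ?Z] by (metis subset_singletonD)
  moreover have "two_three_poly 5 = \<one>\<^bsub>C_alg unit_circle\<^esub>"
    by (auto simp: two_three_poly_def)
  ultimately show ?thesis
    by (simp add: admissible_def two_three_poly_carrier del: C_alg_simps)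
qed

section \<open>Composition with \<open>twist\<close> and its lift to the root space\<close>

lemma composition_alg_hom:
  assumes "continuous_on Y F" "F ` Y \<subseteq> X"
  shows "(\<lambda>h. \<lambda>y\<in>Y. h (F y)) \<in> alg_hom (C_alg X) (C_alg Y)"
proof -
  have "continuous_on Y (\<lambda>y. h (F y))" if "continuous_on X h" for h
    using continuous_on_compose2[OF that assms] .
  moreover have "F y \<in> X" if "y \<in> Y" for y
    using assms(2) that by blast
  ultimately show ?thesis
    unfolding alg_hom_def ring_hom_def by (auto simp: fun_eq_iff)
qed

lemma continuous_on_phase [continuous_intros]:
  "continuous_on S f \<Longrightarrow> continuous_on S (\<lambda>x. phase (f x))"
  unfolding phase_def by (intro continuous_intros)

lemma continuous_on_twist: "continuous_on S twist"
  unfolding twist_def by (intro continuous_intros)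

lemma phase_1 [simp]: "phase 1 = 0"
  by (simp add: phase_def)

lemma twist_image: "twist ` unit_circle \<subseteq> unit_circle"
  by (auto simp: twist_def unit_circle_def norm_mult)

lemma twist_extends_to_root_space:
  "extends_via (pullback unit_circle two_three_poly) (C_alg unit_circle)
     (C_alg (root_space unit_circle two_three_poly)) (\<lambda>h. \<lambda>x\<in>unit_circle. h (twist x))"
proof -
  define Y where "Y = root_space unit_circle two_three_poly"
  define S where "S = (\<lambda>n. {z. cmod (fst z) = 1 \<and> snd z ^ n = fst z})"
  \<comment> \<open>An n-th root of x times \<open>cis (phase x / n)\<close> is an n-th root of
    \<open>twist x\<close>. The two formulas agree at the only common point (1, 1), where the phase
    is 0, so they glue along closed sets.\<close>
  define F where "F = (\<lambda>z. if z \<in> S 2 then (twist (fst z), snd z * cis (phase (fst z) / 2))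
      else (twist (fst z), snd z * cis (phase (fst z) / 3)))"
  have Y: "Y = S 2 \<union> S 3"
    by (simp add: Y_def S_def root_space_two_three_poly)
  have "closed (S n)" for n
    unfolding S_def by (intro closed_Collect_conj closed_Collect_eq continuous_intros)
  moreover have "continuous_on A (\<lambda>z. (twist (fst z), snd z * cis (phase (fst z) / r)))" for A r
    unfolding twist_def by (cases "r = 0") (auto intro!: continuous_intros)
  moreover have "fst z = 1" if "z \<in> S 2" "z \<in> S 3" for z
    using square_eq_cube_imp_one[of "snd z" "fst z"] that by (force simp: S_def)
  ultimately have "continuous_on Y F"
    unfolding Y F_def by (intro continuous_on_cases) auto
  moreover have "F z \<in> Y" if z: "z \<in> Y" for z
    using z unfolding Y F_def
    by (auto simp: S_def twist_def norm_mult power_mult_distrib Complex.DeMoivre)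
  ultimately have T': "(\<lambda>h. \<lambda>y\<in>Y. h (F y)) \<in> alg_End (C_alg Y)"
    by (intro composition_alg_hom) auto
  moreover have "fst (F z) = twist (fst z)" for z
    by (simp add: F_def)
  moreover have "fst z \<in> unit_circle" if "z \<in> Y" for z
    using that by (auto simp: Y_def root_space_def)
  ultimately show ?thesis
    unfolding extends_via_def Y_def[symmetric] using \<open>\<And>z. z \<in> Y \<Longrightarrow> F z \<in> Y\<close>
    by (intro bexI[OF _ T']) (auto simp: pullback_def fun_eq_iff Y_def[symmetric])
qed

section \<open>Continuous choices of roots along an arc, and their monodromy\<close>

lemma root_branch:
  fixes g :: "real \<Rightarrow> real" and u :: "real \<Rightarrow> complex"
  assumes ab: "a < b" and g: "continuous_on {a..b} g" and u: "continuous_on {a..b} u"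
    and root: "\<And>t. t \<in> {a..b} \<Longrightarrow> (u t ^ 2 - cis (g t)) * (u t ^ 3 - cis (g t)) = 0"
    and ne: "\<And>t. t \<in> {a<..<b} \<Longrightarrow> cis (g t) \<noteq> 1"
  obtains n \<zeta> where "n = 2 \<or> n = 3" "\<zeta> ^ n = 1"
    "\<And>t. t \<in> {a..b} \<Longrightarrow> u t = \<zeta> * cis (g t / n)"
proof -
  define A where "A = (\<lambda>n. {t \<in> {a..b}. u t ^ n - cis (g t) \<in> {0}})"
  have closed: "closed (A n)" for n
    unfolding A_def
    by (intro continuous_closed_preimage[unfolded vimage_def Int_def, simplified]
        continuous_intros g u)
  have disj: "A 2 \<inter> A 3 \<inter> {a<..<b} = {}"
  proof (rule ccontr)
    assume "A 2 \<inter> A 3 \<inter> {a<..<b} \<noteq> {}"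
    then obtain t where "t \<in> A 2" "t \<in> A 3" and t_ab: "t \<in> {a<..<b}"
      by blast
    then have t: "u t ^ 2 = cis (g t)" "u t ^ 3 = cis (g t)"
      by (simp_all add: A_def)
    then have "u t = 1"
      by (intro square_eq_cube_imp_one) auto
    with t ne[OF t_ab] show False
      by simp
  qed
  have cover: "{a<..<b} \<subseteq> A 2 \<union> A 3"
  proof
    fix t assume "t \<in> {a<..<b}"
    then show "t \<in> A 2 \<union> A 3"
      using root[of t] by (auto simp: A_def)
  qed
  \<comment> \<open>The open interval is connected and covered by two disjoint relatively closed
    sets, so \<open>u\<close> consists of square roots throughout or of cube roots throughout. Only
    at the end points, where \<open>cis (g t)\<close> may be 1, could it change its kind.\<close>
  have "A 2 \<inter> {a<..<b} = {} \<or> A 3 \<inter> {a<..<b} = {}"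
    using connected_closedD[OF _ disj cover closed closed] by auto
  then obtain n where n: "n = 2 \<or> n = 3" and "{a<..<b} \<subseteq> A n"
    using cover by blast
  then have "closure {a<..<b} \<subseteq> A n"
    using closed by (intro closure_minimal) auto
  then have pow: "u t ^ n = cis (g t)" if "t \<in> {a..b}" for t
    using that ab by (auto simp: A_def)
  \<comment> \<open>Dividing by one continuous branch leaves a continuous function with values in
    the finite set of n-th roots of unity, hence a constant.\<close>
  define v where "v = (\<lambda>t. u t * cis (- (g t / n)))"
  have v: "v t ^ n = 1" if "t \<in> {a..b}" for t
    using pow[OF that] n by (auto simp: v_def power_mult_distrib Complex.DeMoivre cis_mult)
  have "v constant_on {a..b}"
  proof (rule continuous_finite_range_constant)
    show "finite (v ` {a..b})"
      using v n by (intro finite_subset[OF _ finite_nth_roots[of n 1]]) auto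
    show "continuous_on {a..b} v"
      unfolding v_def using n by (intro continuous_intros g u) auto
  qed auto
  then obtain \<zeta> where \<zeta>: "\<And>t. t \<in> {a..b} \<Longrightarrow> v t = \<zeta>"
    by (auto simp: constant_on_def)
  show thesis
  proof (rule that[OF n])
    show "\<zeta> ^ n = 1"
      using v[of a] \<zeta>[of a] ab by simp
    fix t assume "t \<in> {a..b}"
    then have "\<zeta> * cis (g t / n) = v t * cis (g t / n)"
      using \<zeta> by simp
    then show "u t = \<zeta> * cis (g t / n)"
      by (simp add: v_def mult.assoc cis_mult)
  qed
qed

text \<open>
  The branch of \<open>t^n = x\<close> that starts at \<open>(1, a)\<close> ends at \<open>(1, b)\<close> once \<open>x\<close> has run around
  the circle.
\<close>

definition monodromy_step :: "nat \<Rightarrow> complex \<Rightarrow> complex \<Rightarrow> bool" where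
  "monodromy_step n a b \<longleftrightarrow> (n = 2 \<or> n = 3) \<and> a ^ n = 1 \<and> b = a * cis (2 * pi / n)"

text \<open>For the cycle lemmas: these products of -1 and w must not be 1. The first two are
  excluded by Im w > 0, the others by multiplying with w and using w^3 = 1.\<close>

lemma omega_facts:
  defines "w \<equiv> cis (2 * pi / 3)"
  shows "w ^ 3 = 1" "w \<noteq> 1" "- w \<noteq> 1" "w * w \<noteq> 1" "- (w * w) \<noteq> 1"
proof -
  show 3: "w ^ 3 = 1"
    by (simp add: w_def Complex.DeMoivre)
  have "Im w > 0"
    by (simp add: w_def sin_120)
  then have "Im w \<noteq> Im 1" "Im (- w) \<noteq> Im 1"
    by simp_all
  then show ne: "w \<noteq> 1" "- w \<noteq> 1"
    by metis+
  have cube: "w * w * w = 1"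
    using 3 by (simp add: power3_eq_cube)
  show "w * w \<noteq> 1"
    using cube ne by auto
  show "- (w * w) \<noteq> 1"
  proof
    assume "- (w * w) = 1"
    then have "w * w = -1"
      by (metis minus_minus)
    with cube ne show False
      by simp
  qed
qed

lemma monodromy_stepE:
  assumes "monodromy_step n a b"
  obtains s where "a \<noteq> 0" "b = a * s" "n = 2 \<and> s = -1 \<or> n = 3 \<and> s = cis (2 * pi / 3)"
proof (rule that)
  show "a \<noteq> 0"
    using assms by (auto simp: monodromy_step_def power_0_left)
  show "b = a * cis (2 * pi / n)"
    "n = 2 \<and> cis (2 * pi / n) = -1 \<or> n = 3 \<and> cis (2 * pi / n) = cis (2 * pi / 3)"
    using assms by (auto simp: monodromy_step_def)
qed

text \<open>The factors of the two steps multiply to 1. Each is -1 or w =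
  \<open>cis (2 * pi / 3)\<close>, and neither -w nor w^2 is 1.\<close>

lemma monodromy_two_cycle:
  assumes "monodromy_step m a b" "monodromy_step n b a"
  shows "m = 2"
proof -
  obtain s where a: "a \<noteq> 0" and s: "b = a * s" "m = 2 \<and> s = -1 \<or> m = 3 \<and> s = cis (2 * pi / 3)"
    using assms(1) by (elim monodromy_stepE)
  obtain r where r: "a = b * r" "n = 2 \<and> r = -1 \<or> n = 3 \<and> r = cis (2 * pi / 3)"
    using assms(2) by (elim monodromy_stepE)
  have "a * (s * r) = b * r"
    by (simp only: s(1) mult.assoc)
  then have "a * (s * r) = a * 1"
    using r(1) by simp
  with a have "s * r = 1"
    by (simp only: mult_cancel_left) simp
  with s(2) r(2) omega_facts show ?thesis
    by auto
qed

text \<open>The three factors multiply to 1. If the first were -1, the product would be -1, w or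
  -w^2, none of which is 1.\<close>

lemma monodromy_three_cycle:
  assumes "monodromy_step l a b" "monodromy_step m b c" "monodromy_step n c a"
  shows "l = 3"
proof -
  obtain s where a: "a \<noteq> 0" and s: "b = a * s" "l = 2 \<and> s = -1 \<or> l = 3 \<and> s = cis (2 * pi / 3)"
    using assms(1) by (elim monodromy_stepE)
  obtain r where r: "c = b * r" "m = 2 \<and> r = -1 \<or> m = 3 \<and> r = cis (2 * pi / 3)"
    using assms(2) by (elim monodromy_stepE)
  obtain q where q: "a = c * q" "n = 2 \<and> q = -1 \<or> n = 3 \<and> q = cis (2 * pi / 3)"
    using assms(3) by (elim monodromy_stepE)
  have "a * (s * r * q) = c * q"
    by (simp only: s(1) r(1) mult.assoc)
  then have "a * (s * r * q) = a * 1"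
    using q(1) by simp
  with a have "s * r * q = 1"
    by (simp only: mult_cancel_left) simp
  with s(2) r(2) q(2) omega_facts show ?thesis
    by auto
qed

section \<open>The equation for the image of the root coordinate\<close>

lemma C_adj_closed:
  assumes "f \<in> carrier (C_adj X p)" "g \<in> carrier (C_adj X p)"
  shows "f \<oplus>\<^bsub>C_adj X p\<^esub> g \<in> carrier (C_adj X p)"
    and "f \<otimes>\<^bsub>C_adj X p\<^esub> g \<in> carrier (C_adj X p)"
  using assms
  by (auto simp: C_adj_def generated_subalgebra_def unital_subalgebra_def simp del: C_alg_simps)

lemma C_adj_generators:
  "root_proj X p \<in> carrier (C_adj X p)"
  "f \<in> carrier (C_alg X) \<Longrightarrow> pullback X p f \<in> carrier (C_adj X p)"
  by (auto simp: C_adj_def generated_subalgebra_def simp del: C_alg_simps)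

lemma C_adj_ops [simp]:
  "f \<otimes>\<^bsub>C_adj X p\<^esub> g = (\<lambda>z\<in>root_space X p. f z * g z)"
  "f \<oplus>\<^bsub>C_adj X p\<^esub> g = (\<lambda>z\<in>root_space X p. f z + g z)"
  by (simp_all add: C_adj_def)

text \<open>The root coordinate R satisfies (R^2 - x)(R^3 - x) = 0 in C(T)_p. Applying
  \<open>T'\<close> replaces R by its image and x by \<open>twist x\<close>.\<close>

lemma extension_root_equation:
  fixes T :: "(complex \<Rightarrow> complex) \<Rightarrow> complex \<Rightarrow> complex"
  defines "X \<equiv> unit_circle" and "p \<equiv> two_three_poly"
  assumes T: "T = (\<lambda>h. \<lambda>x\<in>X. h (twist x))"
    and T': "T' \<in> alg_End (C_adj X p)"
    and T'_pullback: "\<forall>g\<in>carrier (C_alg X). T' (pullback X p g) = pullback X p (T g)"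
    and z: "z \<in> root_space X p"
  shows "(T' (root_proj X p) z ^ 2 - twist (fst z)) *
    (T' (root_proj X p) z ^ 3 - twist (fst z)) = 0"
proof -
  let ?B = "C_adj X p" and ?P = "root_proj X p" and ?G = "T' (root_proj X p)"
  \<comment> \<open>With -x as a pullback the relation uses only sums and products. Its right side 0
    is also written as a pullback, so the extension condition gives its image too.\<close>
  define neg :: "complex \<Rightarrow> complex" where "neg = (\<lambda>x\<in>X. - x)"
  let ?N = "pullback X p neg"
  let ?Q = "\<lambda>N R. ((R \<otimes>\<^bsub>?B\<^esub> R) \<oplus>\<^bsub>?B\<^esub> N) \<otimes>\<^bsub>?B\<^esub> ((R \<otimes>\<^bsub>?B\<^esub> (R \<otimes>\<^bsub>?B\<^esub> R)) \<oplus>\<^bsub>?B\<^esub> N)"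
  have neg: "neg \<in> carrier (C_alg X)" and zero: "(\<lambda>x\<in>X. 0) \<in> carrier (C_alg X)"
    by (auto simp: neg_def intro!: continuous_intros)
  have fst_X: "fst y \<in> X" if "y \<in> root_space X p" for y
    using that by (auto simp: root_space_def)
  have hom: "T' \<in> ring_hom ?B ?B"
    using T' by (simp add: alg_hom_def)
  note closed = C_adj_generators(1)[of X p] C_adj_generators(2)[OF neg, of p] C_adj_closed
  have "?Q ?N ?P = pullback X p (\<lambda>x\<in>X. 0)"
  proof (rule ext)
    fix y
    show "?Q ?N ?P y = pullback X p (\<lambda>x\<in>X. 0) y"
    proof (cases "y \<in> root_space X p")
      case True
      then have "snd y ^ 2 = fst y \<or> snd y ^ 3 = fst y"
        by (auto simp: X_def p_def root_space_two_three_poly)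
      then show ?thesis
        using True fst_X[OF True]
        by (auto simp: pullback_def root_proj_def neg_def power2_eq_square power3_eq_cube
            mult.assoc)
    qed (simp add: pullback_def)
  qed
  moreover have "T' (?Q ?N ?P) = ?Q (T' ?N) ?G"
    by (simp only: ring_hom_mult[OF hom] ring_hom_add[OF hom] closed)
  ultimately have "?Q (pullback X p (T neg)) ?G = pullback X p (T (\<lambda>x\<in>X. 0))"
    using T'_pullback neg zero by metis
  then have "?Q (pullback X p (T neg)) ?G z = pullback X p (T (\<lambda>x\<in>X. 0)) z"
    by simp
  moreover have "twist (fst z) \<in> X"
    using fst_X[OF z] twist_image by (auto simp: X_def)
  ultimately show ?thesis
    using z fst_X[OF z]
    by (simp add: pullback_def T neg_def power2_eq_square power3_eq_cube mult.assoc)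
qed

section \<open>The angle of \<open>twist\<close> and the rigidity of lifts\<close>

definition twist_angle :: "real \<Rightarrow> real" where
  "twist_angle t = t + phase (cis t)"

lemma twist_cis: "twist (cis t) = cis (twist_angle t)"
  by (simp add: twist_def twist_angle_def cis_mult)

text \<open>The angle stays strictly between 0 and 2 pi: the phase is at most 1 on the upper half
  circle and 0 on the lower one. This lets \<open>root_branch\<close> cover a whole turn.\<close>

lemma cis_twist_angle_neq_1:
  assumes "t \<in> {0<..<2 * pi}"
  shows "cis (twist_angle t) \<noteq> 1"
proof
  have "0 < twist_angle t" "twist_angle t < 2 * pi"
  proof -
    show "0 < twist_angle t"
      using assms by (simp add: twist_angle_def phase_def add_pos_nonneg)
    show "twist_angle t < 2 * pi"
    proof (cases "t \<le> pi")
      case True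
      have "phase (cis t) \<le> 1"
        by (simp add: phase_def real_sqrt_le_1_iff)
      then show ?thesis
        using True pi_gt3 unfolding twist_angle_def by linarith
    next
      case False
      then have "sin t \<le> 0"
        using assms sin_lt_zero[of t] by simp
      then show ?thesis
        using assms by (simp add: twist_angle_def phase_def)
    qed
  qed
  moreover assume "cis (twist_angle t) = 1"
  then have "cos (twist_angle t) = 1"
    by (metis cis.sel(1) one_complex.sel(1))
  then obtain k :: int where "twist_angle t = k * 2 * pi"
    by (auto simp: cos_one_2pi_int)
  ultimately have "0 < k" "k < 1"
    by (simp_all add: zero_less_mult_iff)
  then show False
    by simp
qed

text \<open>
  Monodromy forces \<open>G\<close> to respect the two families of roots: only the square root circle closes
  up after two turns and only the cube root circle after three, and both families meet at
  \<open>(1, 1)\<close>.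
\<close>

lemma lift_of_twist_rigid:
  fixes G :: "complex \<times> complex \<Rightarrow> complex"
  defines "Y \<equiv> root_space unit_circle two_three_poly"
  assumes cont: "continuous_on Y G"
    and root: "\<And>z. z \<in> Y \<Longrightarrow> (G z ^ 2 - twist (fst z)) * (G z ^ 3 - twist (fst z)) = 0"
    and t: "t \<in> {0..2 * pi}" and n: "n = 2 \<or> n = 3"
  shows "G (cis t, cis (t / real n)) = cis (twist_angle t / real n)"
proof -
  define w where "w = (\<lambda>n::nat. cis (2 * pi / n))"
  \<comment> \<open>While x makes one turn, the n-th root starting at c moves to
    \<open>c * w n\<close>, and \<open>G\<close> follows one branch of k-th roots. A priori k need
    not equal n.\<close>
  have branch: "\<exists>k. monodromy_step k (G (1, c)) (G (1, c * w n)) \<and>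
      (\<forall>t\<in>{0..2 * pi}. G (cis t, c * cis (t / n)) = G (1, c) * cis (twist_angle t / k))"
    if n: "n = 2 \<or> n = 3" and c: "c ^ n = 1" for n c
  proof -
    let ?u = "\<lambda>t. G (cis t, c * cis (t / n))"
    have Y: "(cis t, c * cis (t / n)) \<in> Y" for t
      using n c by (auto simp: Y_def root_space_two_three_poly power_mult_distrib Complex.DeMoivre)
    then have "(\<lambda>t. (cis t, c * cis (t / n))) ` {0..2 * pi} \<subseteq> Y"
      by blast
    then have "continuous_on {0..2 * pi} ?u"
      using n by (intro continuous_on_compose2[OF cont] continuous_intros) auto
    moreover have "continuous_on {0..2 * pi} twist_angle"
      unfolding twist_angle_def by (intro continuous_intros)
    ultimately obtain k \<zeta> where k: "k = 2 \<or> k = 3" "\<zeta> ^ k = 1"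
      and u: "\<And>t. t \<in> {0..2 * pi} \<Longrightarrow> ?u t = \<zeta> * cis (twist_angle t / k)"
      using root_branch[of 0 "2 * pi" twist_angle ?u] root[OF Y] cis_twist_angle_neq_1
      by (auto simp: twist_cis)
    \<comment> \<open>This is where degree one enters: the image angle also makes exactly one turn,
      so \<open>G\<close> undergoes a genuine monodromy step.\<close>
    have "twist_angle 0 = 0" "twist_angle (2 * pi) = 2 * pi"
      by (simp_all add: twist_angle_def)
    then have "G (1, c) = \<zeta>" "G (1, c * w n) = \<zeta> * w k"
      using u[of 0] u[of "2 * pi"] by (simp_all add: w_def)
    then show ?thesis
      using k u by (auto simp: monodromy_step_def w_def)
  qed
  have w2: "w 2 = -1" and w3: "w 3 ^ 3 = 1"
    using omega_facts(1) by (simp_all add: w_def)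
  obtain k2 where k2: "monodromy_step k2 (G (1, 1)) (G (1, -1))"
    and G2: "\<forall>t\<in>{0..2 * pi}. G (cis t, cis (t / 2)) = G (1, 1) * cis (twist_angle t / k2)"
    using branch[of 2 1] by (auto simp: w2)
  obtain l2 where "monodromy_step l2 (G (1, -1)) (G (1, 1))"
    using branch[of 2 "-1"] by (auto simp: w2)
  then have "k2 = 2"
    using k2 monodromy_two_cycle by blast
  obtain k3 where k3: "monodromy_step k3 (G (1, 1)) (G (1, w 3))"
    and G3: "\<forall>t\<in>{0..2 * pi}. G (cis t, cis (t / 3)) = G (1, 1) * cis (twist_angle t / k3)"
    using branch[of 3 1] by auto
  obtain l3 where l3: "monodromy_step l3 (G (1, w 3)) (G (1, w 3 * w 3))"
    using branch[of 3 "w 3"] w3 by auto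
  have "(w 3 * w 3) ^ 3 = 1"
    by (simp add: power_mult_distrib w3)
  moreover have "w 3 * w 3 * w 3 = 1"
    using w3 by (simp add: power3_eq_cube)
  ultimately obtain m3 where "monodromy_step m3 (G (1, w 3 * w 3)) (G (1, 1))"
    using branch[of 3 "w 3 * w 3"] by auto
  then have "k3 = 3"
    using k3 l3 monodromy_three_cycle by blast
  \<comment> \<open>Both families start at (1, 1), so its image is a square root and a cube root of
    1 at once. This fixes the remaining constant.\<close>
  have "G (1, 1) ^ 2 = 1" "G (1, 1) ^ 3 = 1"
    using k2 k3 \<open>k2 = 2\<close> \<open>k3 = 3\<close> by (auto simp: monodromy_step_def)
  then have "G (1, 1) = 1"
    by (rule square_eq_cube_imp_one) simp
  with G2 G3 \<open>k2 = 2\<close> \<open>k3 = 3\<close> t n show ?thesis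
    by auto
qed

section \<open>The Lipschitz estimate and the contradiction\<close>

lemma norm_cis_diff: "cmod (cis a - cis b) = 2 * \<bar>sin ((a - b) / 2)\<bar>"
proof -
  have "cis a - cis b = cis b * (cis (a - b) - 1)"
    by (simp add: algebra_simps cis_mult)
  then show ?thesis
    using dist_exp_i_1[of "a - b"] by (simp add: norm_mult cis_conv_exp)
qed

text \<open>Finitely many coefficients occur, each bounded on the compact space, and |l^k - l'^k|
  \<le> k |l - l'| in the unit disc. So one constant serves all fibres.\<close>

lemma C_adj_Lipschitz:
  assumes G: "G \<in> carrier (C_adj X p)" and X: "compact X"
  obtains C where "\<And>x l l'. \<lbrakk>(x, l) \<in> root_space X p; (x, l') \<in> root_space X p; cmod l \<le> 1;
    cmod l' \<le> 1\<rbrakk> \<Longrightarrow> cmod (G (x, l) - G (x, l')) \<le> C * cmod (l - l')"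
proof -
  obtain m q where q: "\<And>k. continuous_on X (q k)"
    and G: "G = (\<lambda>z\<in>root_space X p. \<Sum>k\<le>(m::nat). q k (fst z) * snd z ^ k)"
    using G by (auto simp: carrier_C_adj)
  have "\<exists>M. \<forall>x\<in>X. cmod (q k x) \<le> M" for k
    using compact_imp_bounded[OF compact_continuous_image[OF q X]] by (auto simp: bounded_iff)
  then obtain M where M: "\<And>k x. x \<in> X \<Longrightarrow> cmod (q k x) \<le> M k"
    by metis
  show thesis
  proof
    fix x l l' assume *: "(x, l) \<in> root_space X p" "(x, l') \<in> root_space X p"
      "cmod l \<le> 1" "cmod l' \<le> 1"
    then have x: "x \<in> X"
      by (auto simp: root_space_def)
    have "G (x, l) - G (x, l') = (\<Sum>k\<le>m. q k x * (l ^ k - l' ^ k))"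
      using * by (simp add: G sum_subtractf right_diff_distrib)
    also have "cmod \<dots> \<le> (\<Sum>k\<le>m. M k * (k * cmod (l - l')))"
      unfolding norm_mult using M[OF x] * norm_power_diff
      by (intro sum_norm_le) (auto simp: norm_mult intro!: mult_mono order_trans[OF norm_ge_zero M[OF x]])
    also have "\<dots> = (\<Sum>k\<le>m. M k * k) * cmod (l - l')"
      by (simp add: sum_distrib_right mult.assoc)
    finally show "cmod (G (x, l) - G (x, l')) \<le> (\<Sum>k\<le>m. M k * k) * cmod (l - l')" .
  qed
qed

lemma twist_not_extends_to_C_adj:
  "\<not> extends_via (pullback unit_circle two_three_poly) (C_alg unit_circle)
     (C_adj unit_circle two_three_poly) (\<lambda>h. \<lambda>x\<in>unit_circle. h (twist x))"
proof
  let ?Y = "root_space unit_circle two_three_poly"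
  let ?B = "C_adj unit_circle two_three_poly"
  assume "extends_via (pullback unit_circle two_three_poly) (C_alg unit_circle)
     ?B (\<lambda>h. \<lambda>x\<in>unit_circle. h (twist x))"
  then obtain T' where T': "T' \<in> alg_End ?B" and ext: "\<forall>g\<in>carrier (C_alg unit_circle).
      T' (pullback unit_circle two_three_poly g) =
        pullback unit_circle two_three_poly ((\<lambda>h. \<lambda>x\<in>unit_circle. h (twist x)) g)"
    by (auto simp: extends_via_def)
  define G where "G = T' (root_proj unit_circle two_three_poly)"
  have G: "G \<in> carrier ?B"
    unfolding G_def using T' C_adj_generators(1) by (auto simp: alg_hom_def ring_hom_def)
  then have cont: "continuous_on ?Y G"
    by (auto simp: carrier_C_adj intro!: continuous_intros pullback_continuous)
  have rigid: "G (cis t, cis (t / real n)) = cis (twist_angle t / real n)"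
    if "t \<in> {0..2 * pi}" "n = 2 \<or> n = 3" for t n
    using extension_root_equation[OF refl T' ext] that
    unfolding G_def[symmetric] by (intro lift_of_twist_rigid cont)
  have "compact unit_circle"
    using compact_sphere[of "0::complex" 1] by (simp add: unit_circle_def sphere_def dist_norm)
  then obtain C where C: "\<And>x l l'. \<lbrakk>(x, l) \<in> ?Y; (x, l') \<in> ?Y; cmod l \<le> 1; cmod l' \<le> 1\<rbrakk>
      \<Longrightarrow> cmod (G (x, l) - G (x, l')) \<le> C * cmod (l - l')"
    using C_adj_Lipschitz[OF G] by metis
  \<comment> \<open>Half the difference between one half and one third of an angle is one twelfth of
    it; the factor 2 in both chord lengths cancels.\<close>
  have bound: "\<bar>sin (twist_angle t / 12)\<bar> \<le> C * \<bar>sin (t / 12)\<bar>" if t: "t \<in> {0..2 * pi}" for t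
  proof -
    have "(cis t, cis (t / 2)) \<in> ?Y" "(cis t, cis (t / 3)) \<in> ?Y"
      by (simp_all add: root_space_two_three_poly Complex.DeMoivre)
    then have "cmod (G (cis t, cis (t / 2)) - G (cis t, cis (t / 3)))
        \<le> C * cmod (cis (t / 2) - cis (t / 3))"
      by (intro C) auto
    then show ?thesis
      using rigid[OF t, of 2] rigid[OF t, of 3] by (simp add: norm_cis_diff field_simps)
  qed
  \<comment> \<open>Near 0 the numerator is of order sqrt t and the denominator of order t, so no
    constant C bounds the quotient.\<close>
  have "filterlim (\<lambda>t::real. sin ((t + sqrt (sin t)) / 12) / sin (t / 12)) at_top (at_right 0)"
    by real_asymp
  then have "\<forall>\<^sub>F t in at_right 0. C < sin ((t + sqrt (sin t)) / 12) / sin (t / 12)"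
    by (simp add: filterlim_at_top_dense)
  moreover have "\<forall>\<^sub>F t::real in at_right 0. t \<in> {0<..<pi}"
    by (rule eventually_at_right_real) simp
  ultimately have "\<forall>\<^sub>F t::real in at_right 0. False"
  proof eventually_elim
    case (elim t)
    \<comment> \<open>For 0 < t < pi the maximum in \<open>phase\<close> is sin t, and dividing by
      sin (t / 12) preserves inequalities.\<close>
    have "0 < sin t" "0 < sin (t / 12)"
      using elim by (auto intro!: sin_gt_zero)
    then have "C * \<bar>sin (t / 12)\<bar> < sin (twist_angle t / 12)"
      using elim by (simp add: twist_angle_def phase_def pos_less_divide_eq)
    with bound[of t] elim show ?case
      by auto
  qed
  then show False
    by simp
qed

theorem mainTheorem3:
  shows "\<exists>p T. admissible unit_circle p \<and> T \<in> alg_End (C_alg unit_circle) \<and>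
    extends_via (pullback unit_circle p) (C_alg unit_circle) (C_alg (root_space unit_circle p)) T \<and>
    \<not> extends_via (pullback unit_circle p) (C_alg unit_circle) (C_adj unit_circle p) T"
  using admissible_two_three_poly composition_alg_hom[OF continuous_on_twist twist_image]
    twist_extends_to_root_space twist_not_extends_to_C_adj
  by (intro exI[of _ two_three_poly] exI[of _ "\<lambda>h. \<lambda>x\<in>unit_circle. h (twist x)"] conjI)

end
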